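(* There exist absolute constants $c_1,c_2,c,k>0$ such that the following holds. Let $m,n,t\in\mathbb{N}$ satisfy $n\ge 4\sqrt{m}$ and $1\le t\le \frac{m^{3/2}}{2}$. Let $\mathcal{A}$ be any (randomized) algorithm that has EE (Edge Emptiness) oracle access to an unknown graph $G$ with $n$ vertices and with $c_1 m\le |E(G)|\le c_2 m$ edges, and that decides, with probability at least $2/3$ on every such input, whether the number of triangles in $G$ is at most $t$ or at least $2t$ (under the promise that one of the two holds). Then $\mathcal{A}$ must make at least $$\frac{c}{(\log n)^k}\cdot\min\left\{\sqrt{t},\ \frac{m^{3/2}}{t}\right\}$$ EE queries in the worst case; that is, $\widetilde{\Omega}\left(\min\left\{\sqrt{t},\frac{m^{3/2}}{t}\right\}\right)$ EE queries are necessary.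
   Context: Graphs are finite, simple and undirected. For a graph $G$, $\binom{V(G)}{2}$ is the set of unordered pairs of distinct vertices. The vertex set $V(G)$ and the numbers $m,n,t$ are known to the algorithm, but the edge set is accessible only through the oracle. EE (Edge Emptiness) oracle: given a subset $P\subseteq\binom{V(G)}{2}$, an EE query answers whether there exists $\{u,v\}\in P$ such that $\{u,v\}$ is an edge of $G$. Each query costs one unit, and queries may be adaptive. The notation $\widetilde{\Omega}(\cdot)$ hides a multiplicative factor of the form $1/\mathrm{poly}(\log n)$, and "$\Theta(m)$ edges" means a number of edges between $c_1m$ and $c_2m$ for absolute constants. *)

theory Defs
  imports "HOL-Probability.Probability" "HOL-Library.Ramsey"
begin

text \<open>
  A pair is a two-element set of vertices, so the library's \<open>nsets V 2\<close>, written
  \<open>[V]\<^bsup>2\<^esup>\<close>, is the set of unordered pairs of distinct vertices.  A finite simple undirected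
  graph on a known vertex set \<open>V\<close> is given by its edge set \<open>E \<subseteq> [V]\<^bsup>2\<^esup>\<close>.
\<close>

definition simple_graph :: "'a set \<Rightarrow> 'a set set \<Rightarrow> bool" where
  "simple_graph V E \<longleftrightarrow> finite V \<and> E \<subseteq> [V]\<^bsup>2\<^esup>"

definition triangles :: "'a set \<Rightarrow> 'a set set \<Rightarrow> 'a set set" where
  "triangles V E = {T \<in> [V]\<^bsup>3\<^esup>. [T]\<^bsup>2\<^esup> \<subseteq> E}"

definition EE :: "'a set set \<Rightarrow> 'a set set \<Rightarrow> bool" where
  "EE E P \<longleftrightarrow> (\<exists>e\<in>P. e \<in> E)"

text \<open>Deterministic adaptive algorithms: the continuation of a query receives the oracle's answer.\<close>

datatype 'a ee_tree =
    Output bool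
  | Query "'a set set" "bool \<Rightarrow> 'a ee_tree"

primrec ee_tree_on :: "'a set \<Rightarrow> 'a ee_tree \<Rightarrow> bool" where
  "ee_tree_on V (Output b) \<longleftrightarrow> True"
| "ee_tree_on V (Query P f) \<longleftrightarrow> P \<subseteq> [V]\<^bsup>2\<^esup> \<and> (\<forall>a. ee_tree_on V (f a))"

primrec run_output :: "'a set set \<Rightarrow> 'a ee_tree \<Rightarrow> bool" where
  "run_output E (Output b) = b"
| "run_output E (Query P f) = run_output E (f (EE E P))"

primrec run_queries :: "'a set set \<Rightarrow> 'a ee_tree \<Rightarrow> nat" where
  "run_queries E (Output b) = 0"
| "run_queries E (Query P f) = Suc (run_queries E (f (EE E P)))"

text \<open>
  A randomized algorithm is a probability distribution over decision trees: all coins are tossed in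
  advance.  Using \<^typ>\<open>'a ee_tree pmf\<close> is no restriction, since over a finite vertex set there are
  only countably many trees with admissible queries.  The depth is not assumed to be bounded on the
  support.
\<close>

definition ee_algorithm :: "'a set \<Rightarrow> 'a ee_tree pmf \<Rightarrow> bool" where
  "ee_algorithm V A \<longleftrightarrow> (\<forall>T\<in>set_pmf A. ee_tree_on V T)"

text \<open>
  The worst case is taken over the given class of inputs and over the internal randomness; it is
  \<open>\<infinity>\<close> if the number of queries is unbounded.
\<close>

definition worst_case_queries :: "'a set set set \<Rightarrow> 'a ee_tree pmf \<Rightarrow> enat" where
  "worst_case_queries Inputs A = (SUP E\<in>Inputs. SUP T\<in>set_pmf A. enat (run_queries E T))"

definition promise_inputs ::
  "real \<Rightarrow> real \<Rightarrow> nat \<Rightarrow> nat \<Rightarrow> 'a set \<Rightarrow> 'a set set set" where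
  "promise_inputs c1 c2 m t V =
     {E. simple_graph V E \<and> c1 * real m \<le> real (card E) \<and> real (card E) \<le> c2 * real m \<and>
         (card (triangles V E) \<le> t \<or> card (triangles V E) \<ge> 2 * t)}"

text \<open>
  Output \<^const>\<open>False\<close> means ``at most \<open>t\<close> triangles'', \<^const>\<open>True\<close> means ``at least \<open>2 t\<close>
  triangles''; for \<open>t \<ge> 1\<close> exactly one of the two is correct on every promise input.
\<close>

definition decides_triangles ::
  "real \<Rightarrow> real \<Rightarrow> nat \<Rightarrow> nat \<Rightarrow> 'a set \<Rightarrow> 'a ee_tree pmf \<Rightarrow> bool" where
  "decides_triangles c1 c2 m t V A \<longleftrightarrow>
     (\<forall>E\<in>promise_inputs c1 c2 m t V.
        (card (triangles V E) \<le> t \<longrightarrow>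
           measure_pmf.prob A {T. run_output E T = False} \<ge> 2 / 3) \<and>
        (card (triangles V E) \<ge> 2 * t \<longrightarrow>
           measure_pmf.prob A {T. run_output E T = True} \<ge> 2 / 3))"

end

theory Submission
  imports Defs
begin

text \<open>
  Let \<open>A\<close>, \<open>B\<close>, \<open>C\<close> be disjoint sets of \<open>k = \<lceil>\<surd>m\<rceil>\<close> vertices and let \<open>A\<close> and \<open>B\<close> be completely
  joined.  For \<open>U \<subseteq> C\<close>, joining \<open>U\<close> to \<open>A\<close> and \<open>C - U\<close> to \<open>B\<close> gives a triangle-free graph; joining
  the \<open>s = \<lceil>2t / k\<^sup>2\<rceil>\<close> vertices of a block \<open>S \<subseteq> C\<close> to both sides creates \<open>s k\<^sup>2 \<ge> 2t\<close> triangles.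
  Adding edges can only change answers ``empty'', so a run distinguishes the two graphs only if some
  query answered ``empty'' contains a pair at a vertex of \<open>S\<close>.  Such an answer reveals on which
  side of \<open>U\<close> each vertex touched by the query lies.  Hence a leaf whose empty queries touch \<open>d\<close>
  vertices is reached by at most \<open>2\<^bsup>k-d\<^esup>\<close> sets \<open>U\<close>, and as there are at most \<open>2\<^bsup>q\<^esup>\<close> leaves, the
  average of \<open>2\<^bsup>d\<^esup>\<close> over \<open>U\<close> is at most \<open>2\<^bsup>q\<^esup>\<close>; by convexity the average of \<open>d\<close> is at most \<open>q\<close>.
  With \<open>\<lfloor>k / s\<rfloor>\<close> disjoint blocks, success probability \<open>2/3\<close> forces \<open>q \<ge> \<lfloor>k / s\<rfloor> / 3\<close>.
\<close>

section \<open>Runs of a decision tree and the pairs exposed by empty answers\<close>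

primrec empty_pairs :: "'a set set \<Rightarrow> 'a ee_tree \<Rightarrow> 'a set set" where
  "empty_pairs E (Output b) = {}"
| "empty_pairs E (Query P f) = (if EE E P then {} else P) \<union> empty_pairs E (f (EE E P))"

text \<open>Enlarging the graph keeps every nonempty answer. It can flip an empty answer only if a
  new edge lies in that query, hence in \<open>empty_pairs\<close>, so both runs follow the same
  path.\<close>

lemma run_output_superset:
  assumes "E \<subseteq> E'" "(E' - E) \<inter> empty_pairs E T = {}"
  shows "run_output E' T = run_output E T"
  using assms(2)
proof (induction T)
  case (Query P f)
  have "EE E' P = EE E P"
    using Query.prems assms(1) by (auto simp: EE_def split: if_splits)
  moreover have "(E' - E) \<inter> empty_pairs E (f (EE E P)) = {}"
    using Query.prems by auto
  ultimately show ?case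
    using Query.IH[of "f (EE E P)"] by auto
qed simp

section \<open>Exponential weights of touched vertices\<close>

definition touched :: "'b set \<Rightarrow> ('b \<Rightarrow> 'a set set) \<Rightarrow> 'a set set \<Rightarrow> 'b set" where
  "touched C W P = {c \<in> C. W c \<inter> P \<noteq> {}}"

lemma touched_Un: "touched C W (P \<union> Q) = touched C W P \<union> touched C W Q"
  by (auto simp: touched_def)

lemma touched_subset: "touched C W P \<subseteq> C"
  by (auto simp: touched_def)

text \<open>All members of \<open>X\<close> have the same trace on \<open>D\<close>, so each is
  determined by its part outside \<open>D\<close>.\<close>

lemma card_agreeing_le:
  assumes "finite C" "D \<subseteq> C" "X \<subseteq> Pow C" "\<And>U U'. U \<in> X \<Longrightarrow> U' \<in> X \<Longrightarrow> U \<inter> D = U' \<inter> D"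
  shows "card X * 2 ^ card D \<le> 2 ^ card C"
proof -
  have "inj_on (\<lambda>U. U - D) X"
  proof (rule inj_onI)
    fix U U' assume *: "U \<in> X" "U' \<in> X" "U - D = U' - D"
    have "U \<inter> D = U' \<inter> D" by (rule assms(4)) (use * in auto)
    with * show "U = U'" by blast
  qed
  moreover have "(\<lambda>U. U - D) ` X \<subseteq> Pow (C - D)" using assms(3) by auto
  ultimately have "card X \<le> card (Pow (C - D))"
    using assms(1) by (intro card_inj_on_le) auto
  also have "\<dots> = 2 ^ (card C - card D)"
    using assms(1,2) finite_subset[OF assms(2,1)] by (simp add: card_Pow card_Diff_subset)
  finally have "card X * 2 ^ card D \<le> 2 ^ (card C - card D) * 2 ^ card D"
    by simp
  also have "\<dots> = 2 ^ card C"
    using card_mono[OF assms(1,2)] by (simp flip: power_add)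
  finally show ?thesis .
qed

text \<open>Stated for an arbitrary node of the tree: \<open>X\<close> holds the sets
  \<open>U\<close> whose runs reach it, and \<open>D\<close> the elements whose side has been fixed
  on the way. The condition \<open>det\<close> says that a missing pair from \<open>W c\<close>
  reveals the side of \<open>c\<close>. At a leaf the weight offsets the decrease of
  \<open>X\<close>; at a query each of the two answers accounts for at most half of the
  bound.\<close>

lemma sum_power_touched_le:
  fixes G :: "'b set \<Rightarrow> 'a set set"
  assumes "finite C"
    and det: "\<And>c p U U'. c \<in> C \<Longrightarrow> p \<in> W c \<Longrightarrow> U \<subseteq> C \<Longrightarrow> U' \<subseteq> C \<Longrightarrow> p \<notin> G U \<Longrightarrow> p \<notin> G U' \<Longrightarrow>
                c \<in> U \<longleftrightarrow> c \<in> U'"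
    and "D \<subseteq> C" "X \<subseteq> Pow C" "\<And>U U'. U \<in> X \<Longrightarrow> U' \<in> X \<Longrightarrow> U \<inter> D = U' \<inter> D"
    and "\<And>U. U \<in> X \<Longrightarrow> run_queries (G U) T \<le> q"
  shows "(\<Sum>U\<in>X. 2 ^ card (D \<union> touched C W (empty_pairs (G U) T))) \<le> (2::nat) ^ (q + card C)"
  using assms(3-)
proof (induction T arbitrary: D X q)
  case (Output b)
  have "(\<Sum>U\<in>X. 2 ^ card (D \<union> touched C W (empty_pairs (G U) (Output b)))) = card X * 2 ^ card D"
    by (simp add: touched_def)
  also have "\<dots> \<le> 2 ^ card C"
    by (rule card_agreeing_le[OF assms(1) Output.prems(1-3)])
  also have "\<dots> \<le> 2 ^ (q + card C)" by simp
  finally show ?case .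
next
  case (Query P f)
  show ?case
  \<comment> \<open>For empty \<open>X\<close> the sum vanishes, but \<open>q\<close> may be 0 and
    leave no query to spend.\<close>
  proof (cases "X = {}")
    case False
    then obtain r where q: "q = Suc r"
      using Query.prems(4) by (metis ex_in_conv run_queries.simps(2) Suc_le_D)
    let ?X1 = "{U \<in> X. EE (G U) P}" and ?X0 = "{U \<in> X. \<not> EE (G U) P}"
    let ?D0 = "D \<union> touched C W P"
    let ?w = "\<lambda>D T U. 2 ^ card (D \<union> touched C W (empty_pairs (G U) T)) :: nat"
    have "sum (?w D (f True)) ?X1 \<le> 2 ^ (r + card C)"
    proof (rule Query.IH)
      fix U U' assume "U \<in> ?X1" "U' \<in> ?X1"
      then show "U \<inter> D = U' \<inter> D" by (intro Query.prems(3)) auto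
    next
      fix U assume "U \<in> ?X1"
      then show "run_queries (G U) (f True) \<le> r" using Query.prems(4)[of U] q by simp
    qed (use Query.prems(1,2) in auto)
    moreover have "sum (?w ?D0 (f False)) ?X0 \<le> 2 ^ (r + card C)"
    proof (rule Query.IH)
      fix U U' assume U: "U \<in> ?X0" "U' \<in> ?X0"
      have "c \<in> U \<longleftrightarrow> c \<in> U'" if "c \<in> touched C W P" for c
      proof -
        from that obtain p where p: "c \<in> C" "p \<in> W c" "p \<in> P" by (auto simp: touched_def)
        with U have "p \<notin> G U" "p \<notin> G U'" by (auto simp: EE_def)
        moreover have "U \<subseteq> C" "U' \<subseteq> C" using U Query.prems(2) by auto
        ultimately show ?thesis using det p by blast
      qed
      moreover have "U \<inter> D = U' \<inter> D" using U by (intro Query.prems(3)) auto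
      ultimately show "U \<inter> ?D0 = U' \<inter> ?D0" by blast
    next
      fix U assume "U \<in> ?X0"
      then show "run_queries (G U) (f False) \<le> r" using Query.prems(4)[of U] q by simp
    qed (use Query.prems(1,2) touched_subset[of C W P] in auto)
    \<comment> \<open>After an empty answer the elements touched by \<open>P\<close> move into
      \<open>D\<close>, so each weight is the same at the node and at its child.\<close>
    moreover have "sum (?w D (Query P f)) X = sum (?w D (f True)) ?X1 + sum (?w ?D0 (f False)) ?X0"
    proof -
      have "X = ?X1 \<union> ?X0" by auto
      moreover have "finite X" using Query.prems(2) assms(1) by (meson finite_Pow_iff finite_subset)
      ultimately have "sum (?w D (Query P f)) X
          = sum (?w D (Query P f)) ?X1 + sum (?w D (Query P f)) ?X0"
        by (subst sum.union_disjoint[symmetric]) auto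
      moreover have "sum (?w D (Query P f)) ?X1 = sum (?w D (f True)) ?X1"
        by (rule sum.cong) auto
      moreover have "sum (?w D (Query P f)) ?X0 = sum (?w ?D0 (f False)) ?X0"
        by (rule sum.cong) (auto simp: touched_Un Un_assoc)
      ultimately show ?thesis by simp
    qed
    ultimately show ?thesis by (simp add: q)
  qed simp
qed

text \<open>Jensen's inequality for the convex function 2^x, proved by summing a tangent
  bound.\<close>

lemma sum_card_le_of_sum_power_le:
  fixes d :: "'b \<Rightarrow> nat"
  assumes "finite X" "(\<Sum>x\<in>X. 2 ^ d x) \<le> 2 ^ q * card X"
  shows "(\<Sum>x\<in>X. d x) \<le> q * card X"
proof -
  \<comment> \<open>The right-hand side lies above its tangent at \<open>d x = q\<close>.\<close>
  have *: "2 ^ q * (1 + ln 2 * (real (d x) - real q)) \<le> 2 ^ d x" for x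
  proof -
    have "1 + ln 2 * (real (d x) - real q) \<le> exp (ln 2 * (real (d x) - real q))"
      by (rule exp_ge_add_one_self)
    also have "\<dots> = 2 powr (real (d x) - real q)" by (simp add: powr_def mult.commute)
    also have "\<dots> = 2 ^ d x / 2 ^ q" by (simp add: powr_diff powr_realpow)
    finally show ?thesis by (simp add: field_simps)
  qed
  have "(\<Sum>x\<in>X. 2 ^ q * (1 + ln 2 * (real (d x) - real q))) \<le> (\<Sum>x\<in>X. 2 ^ d x)"
    by (intro sum_mono *)
  also have "\<dots> = real (\<Sum>x\<in>X. 2 ^ d x)" by simp
  also have "\<dots> \<le> real (2 ^ q * card X)" using assms(2) by (intro of_nat_mono)
  also have "\<dots> = 2 ^ q * real (card X)" by simp
  finally have "2 ^ q * (real (card X) + ln 2 * ((\<Sum>x\<in>X. real (d x)) - real q * real (card X)))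
      \<le> 2 ^ q * real (card X)"
    by (simp add: sum.distrib sum_subtractf mult.commute flip: sum_distrib_left)
  then have "ln 2 * ((\<Sum>x\<in>X. real (d x)) - real q * real (card X)) \<le> 0" by simp
  then have "(\<Sum>x\<in>X. real (d x)) - real q * real (card X) \<le> 0"
    by (simp add: mult_le_0_iff)
  then have "real (\<Sum>x\<in>X. d x) \<le> real (q * card X)" by simp
  then show ?thesis by (simp only: of_nat_le_iff)
qed

text \<open>Each element of \<open>D\<close> lies in at most one block, so it can account for only
  one index.\<close>

lemma card_meeting_disjoint_le:
  assumes "finite D" "disjoint_family_on S J"
  shows "card {j \<in> J. S j \<inter> D \<noteq> {}} \<le> card D"
proof -
  have "\<forall>j. \<exists>x. S j \<inter> D \<noteq> {} \<longrightarrow> x \<in> S j \<inter> D" by blast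
  then obtain g where g: "g j \<in> S j \<inter> D" if "S j \<inter> D \<noteq> {}" for j by metis
  have "inj_on g {j \<in> J. S j \<inter> D \<noteq> {}}"
  proof (rule inj_onI)
    fix i j assume "i \<in> {j \<in> J. S j \<inter> D \<noteq> {}}" "j \<in> {j \<in> J. S j \<inter> D \<noteq> {}}" "g i = g j"
    moreover from this have "g i \<in> S i" "g i \<in> S j" using g[of i] g[of j] by simp_all
    ultimately show "i = j" using disjoint_family_onD[OF assms(2), of i j] by blast
  qed
  moreover have "g ` {j \<in> J. S j \<inter> D \<noteq> {}} \<subseteq> D" using g by blast
  ultimately show ?thesis using assms(1) by (rule card_inj_on_le)
qed

section \<open>Complete joins between vertex classes and their triangles\<close>

definition join :: "'a set \<Rightarrow> 'a set \<Rightarrow> 'a set set" where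
  "join X Y = (\<lambda>(x, y). {x, y}) ` (X \<times> Y)"

lemma doubleton_in_join_iff: "{x, y} \<in> join X Y \<longleftrightarrow> x \<in> X \<and> y \<in> Y \<or> y \<in> X \<and> x \<in> Y"
  by (auto simp: join_def doubleton_eq_iff)

lemma card_join:
  assumes "X \<inter> Y = {}"
  shows "card (join X Y) = card X * card Y"
proof -
  have "inj_on (\<lambda>(x, y). {x, y}) (X \<times> Y)"
    using assms by (auto simp: inj_on_def doubleton_eq_iff)
  then show ?thesis by (simp add: join_def card_image card_cartesian_product)
qed

lemma join_commute: "join X Y = join Y X"
  by (force simp: join_def insert_commute)

lemma join_Int_join_eq_empty:
  assumes "X \<inter> (X' \<union> Y') = {}"
  shows "join X Y \<inter> join X' Y' = {}"
proof -
  have "e \<inter> X \<noteq> {}" if "e \<in> join X Y" for e using that by (auto simp: join_def)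
  moreover have "e \<subseteq> X' \<union> Y'" if "e \<in> join X' Y'" for e using that by (auto simp: join_def)
  ultimately show ?thesis using assms by blast
qed

lemma join_subset_nsets:
  assumes "X \<subseteq> V" "Y \<subseteq> V" "X \<inter> Y = {}"
  shows "join X Y \<subseteq> [V]\<^bsup>2\<^esup>"
  using assms by (auto simp: join_def nsets_def card_insert_if)

text \<open>One form for both kinds of instance: \<open>X\<close> and \<open>Y\<close> may partition
  \<open>C\<close>, or overlap in a block whose vertices see both sides.\<close>

definition joined :: "'a set \<Rightarrow> 'a set \<Rightarrow> 'a set \<Rightarrow> 'a set \<Rightarrow> 'a set set" where
  "joined A B X Y = join A B \<union> join A X \<union> join B Y"

context
  fixes A B C V :: "'a set"
  assumes V: "finite V" "A \<subseteq> V" "B \<subseteq> V" "C \<subseteq> V"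
    and disj: "A \<inter> B = {}" "A \<inter> C = {}" "B \<inter> C = {}"
begin

lemma simple_graph_joined:
  assumes "X \<subseteq> C" "Y \<subseteq> C"
  shows "simple_graph V (joined A B X Y)"
proof -
  have "A \<inter> X = {}" "B \<inter> Y = {}" "X \<subseteq> V" "Y \<subseteq> V" using assms disj V by auto
  then show ?thesis
    unfolding simple_graph_def joined_def using V disj by (simp add: join_subset_nsets)
qed

lemma card_joined:
  assumes "X \<subseteq> C" "Y \<subseteq> C"
  shows "card (joined A B X Y) = card A * card B + card A * card X + card B * card Y"
proof -
  have "finite (join P Q)" if "P \<subseteq> V" "Q \<subseteq> V" for P Q
    using that V(1) unfolding join_def by (meson finite_SigmaI finite_imageI finite_subset)
  then have fin: "finite (join A B)" "finite (join A X)" "finite (join B Y)"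
    using V assms by (meson subset_trans)+
  have AX: "A \<inter> X = {}" and BY: "B \<inter> Y = {}" using assms disj by auto
  \<comment> \<open>The separating class comes first; for the first two joins it has to be
    \<open>B\<close>, since \<open>A\<close> occurs in both.\<close>
  have "join B A \<inter> join A X = {}" "join A B \<inter> join B Y = {}" "join A X \<inter> join B Y = {}"
    by (rule join_Int_join_eq_empty; use assms disj in blast)+
  then have "join A B \<inter> join A X = {}" "(join A B \<union> join A X) \<inter> join B Y = {}"
    by (simp_all add: join_commute Int_Un_distrib2)
  then show ?thesis
    unfolding joined_def by (simp add: card_Un_disjoint fin card_join AX BY disj)
qed

text \<open>The edges run along the path X - A - B - Y of pairwise disjoint classes, so the graph is
  bipartite.\<close>

lemma triangles_joined_eq_empty:
  assumes "X \<subseteq> C" "Y \<subseteq> C" "X \<inter> Y = {}"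
  shows "triangles V (joined A B X Y) = {}"
proof (rule equals0I)
  fix T assume T: "T \<in> triangles V (joined A B X Y)"
  then have "card T = 3" by (auto simp: triangles_def nsets_def)
  then obtain x y z where xyz: "T = {x, y, z}" "x \<noteq> y" "x \<noteq> z" "y \<noteq> z"
    by (auto simp: card_3_iff)
  then have "{x, y} \<in> [T]\<^bsup>2\<^esup>" "{x, z} \<in> [T]\<^bsup>2\<^esup>" "{y, z} \<in> [T]\<^bsup>2\<^esup>" by (auto simp: nsets_def)
  then have "{x, y} \<in> joined A B X Y" "{x, z} \<in> joined A B X Y" "{y, z} \<in> joined A B X Y"
    using T by (auto simp: triangles_def)
  moreover have "\<not> (v \<in> A \<and> v \<in> B)" "\<not> (v \<in> A \<and> v \<in> X)" "\<not> (v \<in> A \<and> v \<in> Y)"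
    "\<not> (v \<in> B \<and> v \<in> X)" "\<not> (v \<in> B \<and> v \<in> Y)" "\<not> (v \<in> X \<and> v \<in> Y)" for v
    using assms disj by blast+
  note this[of x] this[of y] this[of z]
  ultimately show False
    unfolding joined_def Un_iff doubleton_in_join_iff by argo
qed

lemma card_triangles_joined_ge:
  assumes "X \<subseteq> C" "Y \<subseteq> C"
  shows "card A * card B * card (X \<inter> Y) \<le> card (triangles V (joined A B X Y))"
proof -
  let ?f = "\<lambda>(a, b, c). {a, b, c}"
  have inj: "inj_on ?f (A \<times> B \<times> (X \<inter> Y))"
  proof (rule inj_onI)
    fix p p' assume p: "p \<in> A \<times> B \<times> (X \<inter> Y)" "p' \<in> A \<times> B \<times> (X \<inter> Y)" "?f p = ?f p'"
    obtain a b c a' b' c' where abc: "p = (a, b, c)" "p' = (a', b', c')" by (metis prod_cases3)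
    with p have *: "a \<in> A" "b \<in> B" "c \<in> X" "a' \<in> A" "b' \<in> B" "c' \<in> X"
        "{a, b, c} = {a', b', c'}"
      by auto
    \<comment> \<open>The classes are disjoint, so intersecting the triangle with a class recovers
      its vertex there.\<close>
    have "{a} = {a, b, c} \<inter> A" "{b} = {a, b, c} \<inter> B" "{c} = {a, b, c} \<inter> C"
      "{a'} = {a', b', c'} \<inter> A" "{b'} = {a', b', c'} \<inter> B" "{c'} = {a', b', c'} \<inter> C"
      using *(1-6) assms disj by blast+
    with *(7) have "a = a' \<and> b = b' \<and> c = c'" by (metis singleton_inject)
    then show "p = p'" by (simp add: abc)
  qed
  have "card A * card B * card (X \<inter> Y) = card (?f ` (A \<times> B \<times> (X \<inter> Y)))"
    unfolding card_image[OF inj] card_cartesian_product by (rule mult.assoc)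
  also have "\<dots> \<le> card (triangles V (joined A B X Y))"
  proof (rule card_mono)
    have "triangles V (joined A B X Y) \<subseteq> Pow V" by (auto simp: triangles_def nsets_def)
    then show "finite (triangles V (joined A B X Y))"
      using V(1) by (meson finite_Pow_iff finite_subset)
    show "?f ` (A \<times> B \<times> (X \<inter> Y)) \<subseteq> triangles V (joined A B X Y)"
    proof clarify
      fix a b c assume abc: "a \<in> A" "b \<in> B" "c \<in> X" "c \<in> Y"
      then have ne: "a \<noteq> b" "a \<noteq> c" "b \<noteq> c" using assms disj by auto
      then have "{a, b, c} \<in> [V]\<^bsup>3\<^esup>" using abc assms V by (auto simp: nsets_def)
      moreover have "e \<in> joined A B X Y" if e: "e \<in> [{a, b, c}]\<^bsup>2\<^esup>" for e
      proof -
        from e obtain x y where "e = {x, y}" "x \<noteq> y" "x \<in> {a, b, c}" "y \<in> {a, b, c}"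
          by (auto simp: nsets_def card_2_iff)
        then show ?thesis using abc by (auto simp: joined_def doubleton_in_join_iff)
      qed
      ultimately show "{a, b, c} \<in> triangles V (joined A B X Y)" by (auto simp: triangles_def)
    qed
  qed
  finally show ?thesis .
qed

section \<open>Query bound from disjoint blocks\<close>

lemma sum_touched_joined_le:
  assumes "\<And>U. U \<subseteq> C \<Longrightarrow> run_queries (joined A B U (C - U)) T \<le> q"
  shows "(\<Sum>U\<in>Pow C. card (touched C (\<lambda>c. join (A \<union> B) {c})
           (empty_pairs (joined A B U (C - U)) T))) \<le> q * 2 ^ card C"
proof -
  let ?W = "\<lambda>c. join (A \<union> B) {c}" and ?G = "\<lambda>U. joined A B U (C - U)"
  have fin: "finite C" using V finite_subset by blast
  have "(\<Sum>U\<in>Pow C. 2 ^ card ({} \<union> touched C ?W (empty_pairs (?G U) T))) \<le> (2::nat) ^ (q + card C)"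
  proof (rule sum_power_touched_le)
    fix c p U U'
    assume *: "c \<in> C" "p \<in> ?W c" "U \<subseteq> C" "U' \<subseteq> C" "p \<notin> ?G U" "p \<notin> ?G U'"
    then obtain v where v: "v \<in> A \<union> B" "p = {v, c}" by (auto simp: join_def)
    \<comment> \<open>If \<open>v\<close> is in \<open>A\<close>, the missing pair says that
      \<open>c\<close> is not in \<open>U\<close>; if \<open>v\<close> is in \<open>B\<close>, that
      \<open>c\<close> is in \<open>U\<close>.\<close>
    show "c \<in> U \<longleftrightarrow> c \<in> U'"
      using v * unfolding v(2) joined_def Un_iff doubleton_in_join_iff by blast
  qed (use fin assms in auto)
  \<comment> \<open>Read as an average over all \<open>U\<close>, the weight is at most
    \<open>2 ^ q\<close>.\<close>
  then have "(\<Sum>U\<in>Pow C. 2 ^ card (touched C ?W (empty_pairs (?G U) T))) \<le> 2 ^ q * card (Pow C)"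
    by (simp only: card_Pow[OF fin] power_add Un_empty_left)
  then have "(\<Sum>U\<in>Pow C. card (touched C ?W (empty_pairs (?G U) T))) \<le> q * card (Pow C)"
    by (rule sum_card_le_of_sum_power_le[rotated]) (simp add: fin)
  then show ?thesis by (simp add: card_Pow fin)
qed

text \<open>Planting \<open>S j\<close> changes the output only if \<open>S j\<close> contains a
  touched vertex. As the blocks are disjoint, a given \<open>U\<close> has at most as many such
  \<open>j\<close> as touched vertices.\<close>

lemma card_distinguished_le:
  assumes "\<And>U. U \<subseteq> C \<Longrightarrow> run_queries (joined A B U (C - U)) T \<le> q"
    and S: "disjoint_family_on S J" "\<And>j. j \<in> J \<Longrightarrow> S j \<subseteq> C" "finite J"
  shows "card {(U, j). U \<in> Pow C \<and> j \<in> J \<and>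
           run_output (joined A B (U \<union> S j) (C - U \<union> S j)) T
             \<noteq> run_output (joined A B U (C - U)) T} \<le> q * 2 ^ card C"
    (is "card ?Z \<le> _")
proof -
  let ?D = "\<lambda>U. touched C (\<lambda>c. join (A \<union> B) {c}) (empty_pairs (joined A B U (C - U)) T)"
  have fin: "finite C" using V finite_subset by blast
  have finD: "finite (?D U)" for U using touched_subset fin by (rule finite_subset)
  have "?Z \<subseteq> Sigma (Pow C) (\<lambda>U. {j \<in> J. S j \<inter> ?D U \<noteq> {}})"
  proof
    fix z assume "z \<in> ?Z"
    then obtain U j where z: "z = (U, j)" and U: "U \<subseteq> C" "j \<in> J" and ne: "run_output (joined A B (U \<union> S j) (C - U \<union> S j)) T
                 \<noteq> run_output (joined A B U (C - U)) T"
      by blast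
    have "\<not> (joined A B (U \<union> S j) (C - U \<union> S j) - joined A B U (C - U)) \<inter>
            empty_pairs (joined A B U (C - U)) T = {}"
    proof
      assume "(joined A B (U \<union> S j) (C - U \<union> S j) - joined A B U (C - U)) \<inter>
            empty_pairs (joined A B U (C - U)) T = {}"
      moreover have "joined A B U (C - U) \<subseteq> joined A B (U \<union> S j) (C - U \<union> S j)"
        by (auto simp: joined_def join_def)
      ultimately show False using ne run_output_superset by blast
    qed
    then obtain p where p: "p \<in> joined A B (U \<union> S j) (C - U \<union> S j)" "p \<notin> joined A B U (C - U)"
        "p \<in> empty_pairs (joined A B U (C - U)) T"
      by blast
    \<comment> \<open>An edge that planting adds must end in the planted block.\<close>
    then obtain c where c: "c \<in> S j" "p \<in> join (A \<union> B) {c}"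
      by (auto simp: joined_def join_def)
    then have "c \<in> ?D U" using p(3) S(2)[OF U(2)] by (auto simp: touched_def)
    with c U show "z \<in> Sigma (Pow C) (\<lambda>U. {j \<in> J. S j \<inter> ?D U \<noteq> {}})" unfolding z by blast
  qed
  then have "card ?Z \<le> card (Sigma (Pow C) (\<lambda>U. {j \<in> J. S j \<inter> ?D U \<noteq> {}}))"
    by (rule card_mono[rotated]) (intro finite_SigmaI, simp_all add: fin S(3))
  also have "\<dots> = (\<Sum>U\<in>Pow C. card {j \<in> J. S j \<inter> ?D U \<noteq> {}})"
    using fin S by (intro card_SigmaI) auto
  also have "\<dots> \<le> (\<Sum>U\<in>Pow C. card (?D U))"
    by (intro sum_mono card_meeting_disjoint_le finD S)
  also have "\<dots> \<le> q * 2 ^ card C" by (rule sum_touched_joined_le) (rule assms(1))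
  finally show ?thesis .
qed

text \<open>Double counting of triples of tree, \<open>U\<close> and \<open>j\<close>: each pair
  (\<open>U\<close>, \<open>j\<close>) is distinguished with probability at least 1/3, while each
  tree distinguishes at most \<open>q * 2 ^ card C\<close> of the \<open>card J * 2 ^ card C\<close>
  pairs.\<close>

lemma queries_ge_card_blocks:
  fixes M :: "'a ee_tree pmf"
  assumes q: "\<And>T U. T \<in> set_pmf M \<Longrightarrow> U \<subseteq> C \<Longrightarrow> run_queries (joined A B U (C - U)) T \<le> q"
    and S: "disjoint_family_on S J" "\<And>j. j \<in> J \<Longrightarrow> S j \<subseteq> C" "finite J"
    and no: "\<And>U. U \<subseteq> C \<Longrightarrow>
      measure_pmf.prob M {T. run_output (joined A B U (C - U)) T = False} \<ge> 2 / 3"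
    and yes: "\<And>U j. U \<subseteq> C \<Longrightarrow> j \<in> J \<Longrightarrow>
      measure_pmf.prob M {T. run_output (joined A B (U \<union> S j) (C - U \<union> S j)) T = True} \<ge> 2 / 3"
  shows "card J \<le> 3 * q"
proof -
  let ?G = "\<lambda>U. joined A B U (C - U)" and ?H = "\<lambda>U j. joined A B (U \<union> S j) (C - U \<union> S j)"
  let ?d = "\<lambda>(U, j). {T. run_output (?H U j) T \<noteq> run_output (?G U) T}"
  have fin: "finite C" using V finite_subset by blast
  have int: "integrable (measure_pmf M) (indicator (?d z) :: _ \<Rightarrow> real)" for z
    by (rule measure_pmf.integrable_const_bound[where B = 1]) auto
  have "1 / 3 \<le> measure_pmf.prob M (?d z)" if z_in: "z \<in> Pow C \<times> J" for z
  proof -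
    obtain U j where z: "z = (U, j)" "U \<subseteq> C" "j \<in> J" using z_in by auto
    let ?N = "{T. run_output (?G U) T = False}" and ?Y = "{T. run_output (?H U j) T = True}"
    have "2 / 3 \<le> measure_pmf.prob M ?Y" by (rule yes) (use z in auto)
    \<comment> \<open>Answering \<open>True\<close> on the planted graph means that the outputs
      differ or that the triangle-free graph is answered wrongly.\<close>
    also have "\<dots> \<le> measure_pmf.prob M (?d z \<union> - ?N)"
      by (rule measure_pmf.finite_measure_mono) (auto simp: z)
    also have "\<dots> \<le> measure_pmf.prob M (?d z) + measure_pmf.prob M (- ?N)"
      by (rule measure_Un_le) auto
    also have "measure_pmf.prob M (- ?N) = 1 - measure_pmf.prob M ?N"
      using measure_pmf.prob_compl[of ?N M] by (simp add: Compl_eq_Diff_UNIV)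
    finally show ?thesis using no[OF z(2)] by linarith
  qed
  then have "real (card (Pow C \<times> J)) * (1 / 3) \<le> (\<Sum>z\<in>Pow C \<times> J. measure_pmf.prob M (?d z))"
    by (rule sum_bounded_below)
  also have "\<dots> = measure_pmf.expectation M (\<lambda>T. \<Sum>z\<in>Pow C \<times> J. indicator (?d z) T)"
    by (subst Bochner_Integration.integral_sum[OF int]) auto
  also have "\<dots> \<le> real (q * 2 ^ card C)"
  proof (rule measure_pmf.integral_le_const)
    show "integrable (measure_pmf M) (\<lambda>T. \<Sum>z\<in>Pow C \<times> J. indicator (?d z) T :: real)"
      by (intro Bochner_Integration.integrable_sum int)
    show "AE T in measure_pmf M. (\<Sum>z\<in>Pow C \<times> J. indicator (?d z) T) \<le> real (q * 2 ^ card C)"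
    proof (subst AE_measure_pmf_iff, rule ballI)
      fix T assume T: "T \<in> set_pmf M"
      have "(\<Sum>z\<in>Pow C \<times> J. indicator (?d z) T) = (\<Sum>z\<in>Pow C \<times> J. if T \<in> ?d z then 1 else (0::real))"
        by (simp add: indicator_def of_bool_def)
      also have "\<dots> = real (card {z \<in> Pow C \<times> J. T \<in> ?d z})"
        using fin S by (simp add: sum.If_cases Int_def)
      also have "{z \<in> Pow C \<times> J. T \<in> ?d z} = {(U, j). U \<in> Pow C \<and> j \<in> J \<and>
          run_output (?H U j) T \<noteq> run_output (?G U) T}"
        by auto
      also have "card \<dots> \<le> q * 2 ^ card C"
        by (rule card_distinguished_le[OF q[OF T] S])
      finally show "(\<Sum>z\<in>Pow C \<times> J. indicator (?d z) T) \<le> real (q * 2 ^ card C)"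
        by simp
    qed
  qed
  finally have "real (card J) \<le> real (3 * q)"
    using fin by (simp add: card_cartesian_product card_Pow)
  then show ?thesis by (simp only: of_nat_le_iff)
qed

end

section \<open>Choice of parameters and the final estimate\<close>

lemma ceiling_sqrt_bounds:
  fixes m :: nat
  assumes "m \<ge> 1"
  defines "k \<equiv> nat \<lceil>sqrt (real m)\<rceil>"
  shows "1 \<le> k" "sqrt (real m) \<le> real k" "real k < sqrt (real m) + 1" "m \<le> k\<^sup>2" "k\<^sup>2 \<le> 4 * m"
    "(k - 1)\<^sup>2 + 1 \<le> m"
proof -
  have s1: "1 \<le> sqrt (real m)" using assms(1) by simp
  show le: "sqrt (real m) \<le> real k" unfolding k_def by (rule real_nat_ceiling_ge)
  show less: "real k < sqrt (real m) + 1" unfolding k_def using s1 by linarith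
  show k1: "1 \<le> k" using s1 le by linarith
  have sq: "(sqrt (real m))\<^sup>2 = real m" by simp
  have "real m \<le> (real k)\<^sup>2" using le s1 sq by (metis power_mono real_sqrt_ge_zero of_nat_0_le_iff)
  then show "m \<le> k\<^sup>2" by (simp flip: of_nat_power)
  have "real k \<le> 2 * sqrt (real m)" using less s1 by linarith
  then have "(real k)\<^sup>2 \<le> (2 * sqrt (real m))\<^sup>2" by (intro power_mono) auto
  also have "\<dots> = real (4 * m)" by (simp add: power_mult_distrib)
  finally show "k\<^sup>2 \<le> 4 * m" by (simp flip: of_nat_power)
  have "(real (k - 1))\<^sup>2 < (sqrt (real m))\<^sup>2"
    using less k1 by (intro power_strict_mono) auto
  \<comment> \<open>Integrality turns strictness into the extra 1 that later makes three classes of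
    size \<open>k\<close> fit into \<open>n\<close> vertices.\<close>
  then have "(k - 1)\<^sup>2 < m" unfolding sq by (simp flip: of_nat_power)
  then show "(k - 1)\<^sup>2 + 1 \<le> m" by simp
qed

theorem theorem3p1:
  "\<exists>c1 c2 c k :: real. c1 > 0 \<and> c2 > 0 \<and> c > 0 \<and> k > 0 \<and>
     (\<forall>(m::nat) (n::nat) (t::nat).
        real n \<ge> 4 * sqrt (real m) \<longrightarrow> 1 \<le> t \<longrightarrow> real t \<le> real m powr (3 / 2) / 2 \<longrightarrow>
        (\<forall>A :: nat ee_tree pmf.
           ee_algorithm {..<n} A \<longrightarrow> decides_triangles c1 c2 m t {..<n} A \<longrightarrow>
           ereal_of_enat (worst_case_queries (promise_inputs c1 c2 m t {..<n}) A) \<ge>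
             ereal (c / ln (real n) powr k *
                      min (sqrt (real t)) (real m powr (3 / 2) / real t))))"
proof (intro exI conjI allI impI)
  \<comment> \<open>The graphs have between k^2 >= m and 3k^2 <= 12m edges. The factor 24 is 3 from
    the success probability, 2 from rounding k/s down and 4 from 2t/k^2 rounded up.\<close>
  show "(1::real) > 0" "(12::real) > 0" "(1 / 24::real) > 0" "(1::real) > 0" by auto
  fix m n t :: nat and M :: "nat ee_tree pmf"
  assume n: "4 * sqrt (real m) \<le> real n" and t: "1 \<le> t" "real t \<le> real m powr (3 / 2) / 2"
    and dec: "decides_triangles 1 12 m t {..<n} M"
  define k where "k = nat \<lceil>sqrt (real m)\<rceil>"
  define s where "s = nat \<lceil>2 * real t / real (k\<^sup>2)\<rceil>"
  define J where "J = {..<k div s}"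
  define S where "S j = {2 * k + j * s..<2 * k + (j + 1) * s}" for j
  let ?A = "{..<k}" and ?B = "{k..<2 * k}" and ?C = "{2 * k..<3 * k}" and ?V = "{..<n}"
  let ?I = "promise_inputs 1 12 m t ?V"

  have m: "m \<ge> 2"
  proof (rule ccontr)
    assume "\<not> m \<ge> 2"
    then consider "m = 0" | "m = 1" by linarith
    then show False using t by cases auto
  qed
  have m32: "real m powr (3 / 2) = sqrt (real m) ^ 3"
    using m by (simp add: powr_half_sqrt[symmetric] powr_powr flip: powr_numeral)
  have "m \<ge> 1" using m by simp
  note k = ceiling_sqrt_bounds[OF this, folded k_def]
  have n3k: "3 * k \<le> n"
  proof -
    have "16 * real m \<le> (real n)\<^sup>2"
      using power_mono[OF n, of 2] by (simp add: power_mult_distrib)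
    then have "16 * m \<le> n\<^sup>2" by (simp flip: of_nat_power)
    with mult_le_mono2[OF k(6), of 16] have "16 * ((k - 1)\<^sup>2 + 1) \<le> n\<^sup>2" by (rule le_trans)
    moreover obtain j where j: "k = Suc j" using k(1) by (metis not0_implies_Suc not_one_le_zero)
    ultimately have "16 * j\<^sup>2 + 16 \<le> n\<^sup>2" by simp
    moreover have "(3 * j + 2)\<^sup>2 < 16 * j\<^sup>2 + 16"
    proof -
      \<comment> \<open>Completing the square in 16j^2 + 16 - (3j + 2)^2 = 7j^2 - 12j + 12.\<close>
      have "0 < 7 * (real j - 6 / 7)\<^sup>2 + 48 / 7"
        by (rule add_nonneg_pos) auto
      then have "(3 * real j + 2)\<^sup>2 < 16 * (real j)\<^sup>2 + 16"
        by (simp add: power2_eq_square algebra_simps)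
      then have "real ((3 * j + 2)\<^sup>2) < real (16 * j\<^sup>2 + 16)" by (simp add: add.commute)
      then show ?thesis by (simp only: of_nat_less_iff)
    qed
    ultimately have "(3 * j + 2)\<^sup>2 < n\<^sup>2" by linarith
    then have "3 * j + 2 < n" by (rule power_less_imp_less_base) simp
    then show ?thesis using j by simp
  qed
  \<comment> \<open>This yields \<open>s <= k\<close>, so that at least one block fits into
    \<open>?C\<close>.\<close>
  have k3: "2 * real t \<le> real k ^ 3"
  proof -
    have "2 * real t \<le> sqrt (real m) ^ 3" using t m32 by simp
    also have "\<dots> \<le> real k ^ 3" using k(2) by (intro power_mono) auto
    finally show ?thesis .
  qed
  have s_ge: "2 * real t / real (k\<^sup>2) \<le> real s" unfolding s_def by (rule real_nat_ceiling_ge)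
  have s_pos: "1 \<le> s"
  proof -
    have "0 < 2 * real t / real (k\<^sup>2)" using t k(1) by auto
    then show ?thesis using s_ge by linarith
  qed
  have s_le_k: "s \<le> k"
  proof -
    have "2 * real t / real (k\<^sup>2) \<le> real k"
      using k3 k(1) by (simp add: field_simps power2_eq_square power3_eq_cube)
    then show ?thesis unfolding s_def by linarith
  qed
  have st: "2 * t \<le> k * k * s"
  proof -
    have "2 * real t \<le> real s * real (k\<^sup>2)" using s_ge k(1) by (simp add: field_simps)
    then have "real (2 * t) \<le> real (k * k * s)" by (simp add: power2_eq_square mult_ac)
    then show ?thesis by (simp only: of_nat_le_iff)
  qed

  have ctx: "finite ?V" "?A \<subseteq> ?V" "?B \<subseteq> ?V" "?C \<subseteq> ?V"
    "?A \<inter> ?B = {}" "?A \<inter> ?C = {}" "?B \<inter> ?C = {}"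
    using n3k by auto
  have cards: "card ?A = k" "card ?B = k" "card ?C = k" by auto

  have S_sub: "S j \<subseteq> ?C" if "j \<in> J" for j
  proof -
    have "(j + 1) * s \<le> (k div s) * s" using that unfolding J_def by (intro mult_right_mono) auto
    also have "\<dots> \<le> k" by simp
    finally show ?thesis unfolding S_def by auto
  qed
  have S_card: "card (S j) = s" for j unfolding S_def by simp
  have S_disj: "disjoint_family_on S J"
  proof -
    have "S i \<inter> S j = {}" if "i < j" for i j
    proof -
      have "(i + 1) * s \<le> j * s" using that by (intro mult_right_mono) auto
      then show ?thesis unfolding S_def by auto
    qed
    then show ?thesis unfolding disjoint_family_on_def by (metis Int_commute linorder_neqE_nat)
  qed

  have edges: "m \<le> card (joined ?A ?B X Y) \<and> card (joined ?A ?B X Y) \<le> 12 * m"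
    if "X \<subseteq> ?C" "Y \<subseteq> ?C" for X Y
  proof -
    have "card X \<le> k" "card Y \<le> k" using that card_mono[of ?C] cards by (metis finite_atLeastLessThan)+
    then have "k * card X \<le> k * k" "k * card Y \<le> k * k" by (auto intro: mult_left_mono)
    then show ?thesis
      using k(4,5) unfolding card_joined[OF ctx that] cards power2_eq_square by linarith
  qed
  have in_I: "joined ?A ?B X Y \<in> ?I"
    if "X \<subseteq> ?C" "Y \<subseteq> ?C"
      "card (triangles ?V (joined ?A ?B X Y)) \<le> t \<or> 2 * t \<le> card (triangles ?V (joined ?A ?B X Y))"
    for X Y
  proof -
    have "real m \<le> real (card (joined ?A ?B X Y))" "real (card (joined ?A ?B X Y)) \<le> real (12 * m)"
      using edges[OF that(1,2)] by (simp_all only: of_nat_le_iff)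
    then show ?thesis
      unfolding promise_inputs_def using simple_graph_joined[OF ctx that(1,2)] that(3) by simp
  qed

  have no_tri: "card (triangles ?V (joined ?A ?B U (?C - U))) \<le> t" if "U \<subseteq> ?C" for U
    using triangles_joined_eq_empty[OF ctx that, of "?C - U"] by auto
  have yes_tri: "2 * t \<le> card (triangles ?V (joined ?A ?B (U \<union> S j) (?C - U \<union> S j)))"
    if "U \<subseteq> ?C" "j \<in> J" for U j
  proof -
    have sub: "U \<union> S j \<subseteq> ?C" "?C - U \<union> S j \<subseteq> ?C" using that S_sub by auto
    have "(U \<union> S j) \<inter> (?C - U \<union> S j) = S j" by auto
    with card_triangles_joined_ge[OF ctx sub] st S_card[of j] show ?thesis
      unfolding cards by simp
  qed

  show "ereal (1 / 24 / ln (real n) powr 1 * min (sqrt (real t)) (real m powr (3 / 2) / real t))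
      \<le> ereal_of_enat (worst_case_queries ?I M)"
  proof (cases "worst_case_queries ?I M")
    case (enat q)
    have q: "run_queries (joined ?A ?B U (?C - U)) T \<le> q" if "T \<in> set_pmf M" "U \<subseteq> ?C" for T U
    proof -
      have "joined ?A ?B U (?C - U) \<in> ?I" using that no_tri by (intro in_I) auto
      then have "enat (run_queries (joined ?A ?B U (?C - U)) T) \<le> worst_case_queries ?I M"
        unfolding worst_case_queries_def using that(1) by (meson SUP_upper SUP_upper2)
      then show ?thesis by (simp add: enat)
    qed
    have "card J \<le> 3 * q"
    proof (rule queries_ge_card_blocks[OF ctx q S_disj S_sub])
      fix U assume U: "U \<subseteq> ?C"
      then have "joined ?A ?B U (?C - U) \<in> ?I" using no_tri by (intro in_I) auto
      then show "2 / 3 \<le> measure_pmf.prob M {T. run_output (joined ?A ?B U (?C - U)) T = False}"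
        using dec no_tri[OF U] unfolding decides_triangles_def by blast
    next
      fix U j assume U: "U \<subseteq> ?C" "j \<in> J"
      then have "joined ?A ?B (U \<union> S j) (?C - U \<union> S j) \<in> ?I"
        using yes_tri S_sub by (intro in_I) auto
      then show "2 / 3 \<le> measure_pmf.prob M
          {T. run_output (joined ?A ?B (U \<union> S j) (?C - U \<union> S j)) T = True}"
        using dec yes_tri[OF U] unfolding decides_triangles_def by blast
    qed (auto simp: J_def)
    then have "k div s \<le> 3 * q" by (simp add: J_def)
    then have "2 * (k div s) * s \<le> 6 * q * s" by simp
    \<comment> \<open>The quotient is at least 1, so rounding down costs at most a factor 2.\<close>
    moreover have "k \<le> 2 * (k div s) * s"
    proof -
      have "1 \<le> k div s" using s_le_k s_pos by (simp add: div_greater_zero_iff Suc_le_eq)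
      then have "s \<le> (k div s) * s" by simp
      moreover have "k mod s < s" using s_pos by simp
      ultimately show ?thesis using div_mult_mod_eq[of k s] by linarith
    qed
    ultimately have "real k \<le> real (6 * q * s)" by linarith
    then have kq: "real k \<le> 6 * real q * real s" by simp

    let ?mn = "min (sqrt (real t)) (real m powr (3 / 2) / real t)"
    have "?mn \<le> 24 * real q"
    \<comment> \<open>For small t a block is a single vertex, and k >= sqrt t gives the first term
      of the minimum. Otherwise k/s is of order k^3/t, which gives the second.\<close>
    proof (cases "2 * t \<le> k\<^sup>2")
      case True
      then have "real (2 * t) \<le> real (k\<^sup>2)" by (simp only: of_nat_le_iff)
      then have "2 * real t / real (k\<^sup>2) \<le> 1" using k(1) by (simp add: field_simps)
      then have "s \<le> 1" unfolding s_def by linarith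
      with kq s_pos have "real k \<le> 6 * real q" by simp
      moreover have "sqrt (real t) \<le> real k"
      proof (rule real_le_lsqrt)
        have "t \<le> k\<^sup>2" using True by simp
        then show "real t \<le> (real k)\<^sup>2" by (simp flip: of_nat_power)
      qed auto
      ultimately show ?thesis by (simp add: min_le_iff_disj)
    next
      case False
      then have "real (k\<^sup>2) \<le> real (2 * t)" by (simp only: of_nat_le_iff)
      then have "1 \<le> 2 * real t / real (k\<^sup>2)" using k(1) by (simp add: field_simps)
      \<comment> \<open>The ceiling of x is at most 2x for x >= 1, here with x = 2t/k^2.\<close>
      then have "real s \<le> 4 * real t / real (k\<^sup>2)" unfolding s_def by linarith
      then have "6 * real q * real s \<le> 6 * real q * (4 * real t / real (k\<^sup>2))"
        by (intro mult_left_mono) auto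
      with kq have "real k \<le> 24 * real q * real t / real (k\<^sup>2)" by simp
      then have "real k ^ 3 \<le> 24 * real q * real t"
        using k(1) by (simp add: field_simps power2_eq_square power3_eq_cube)
      moreover have "sqrt (real m) ^ 3 \<le> real k ^ 3" using k(2) by (intro power_mono) auto
      ultimately have "sqrt (real m) ^ 3 \<le> 24 * real q * real t" by linarith
      then have "real m powr (3 / 2) / real t \<le> 24 * real q"
        using t(1) m32 by (simp add: field_simps)
      then show ?thesis by (simp add: min_le_iff_disj)
    qed
    \<comment> \<open>As n >= 3 > e, division by \<open>ln n\<close> can only decrease the
      minimum.\<close>
    moreover have ln_ge: "1 \<le> ln (real n)"
    proof -
      have "3 \<le> n" using n3k k(1) by linarith
      then have "exp 1 \<le> real n" using exp_le by linarith
      then show ?thesis using \<open>3 \<le> n\<close> by (subst ln_ge_iff) auto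
    qed
    then have "?mn / ln (real n) \<le> ?mn / 1" by (intro divide_left_mono) auto
    then have "?mn / ln (real n) \<le> ?mn" by (simp only: div_by_1)
    ultimately have "?mn / ln (real n) \<le> 24 * real q" by (rule order_trans[rotated])
    then have "?mn / ln (real n) / 24 \<le> real q" by (subst pos_divide_le_eq, simp) (simp only: mult.commute)
    moreover have "1 / 24 / ln (real n) powr 1 * ?mn = ?mn / ln (real n) / 24"
      using ln_ge by simp
    ultimately have "1 / 24 / ln (real n) powr 1 * ?mn \<le> real q" by (simp only:)
    then show ?thesis by (simp add: enat)
  qed simp
qed

end
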